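(* Let $n\ge 1$ be an integer and let $B$ be the open unit ball of $\mathbb{R}^{n+1}$. There exist a harmonic function $U$ in $B$ and positive constants $C$, $C_1$ such that $$U(z)\le C(1-|z|)^{-n}\quad\text{for all } z\in B,$$ and $$U(r,0,\dots,0)\le -C_1(1-r)^{-n}\left(\log\frac{1}{1-r}\right)^{n+1}$$ for all $r\in(0,1)$ sufficiently close to $1$. *)

theory Defs
  imports "HOL-Analysis.Analysis"
begin

definition partial_deriv :: "'a::euclidean_space \<Rightarrow> ('a \<Rightarrow> real) \<Rightarrow> 'a \<Rightarrow> real" where
  "partial_deriv b f x = frechet_derivative f (at x) b"

text \<open>Since \<^const>\<open>frechet_derivative\<close> is unspecified at points of
  non-differentiability, differentiability of \<open>f\<close> and of its first partial
  derivatives is required separately. On an open set the condition is the usual \<open>C\<^sup>2\<close>.\<close>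

definition C2_on :: "('a::euclidean_space \<Rightarrow> real) \<Rightarrow> 'a set \<Rightarrow> bool" where
  "C2_on f S \<longleftrightarrow>
     (\<forall>x\<in>S. f differentiable at x) \<and>
     (\<forall>b\<in>Basis. \<forall>x\<in>S. partial_deriv b f differentiable at x) \<and>
     (\<forall>b\<in>Basis. \<forall>c\<in>Basis. continuous_on S (partial_deriv c (partial_deriv b f)))"

definition laplacian :: "('a::euclidean_space \<Rightarrow> real) \<Rightarrow> 'a \<Rightarrow> real" where
  "laplacian f x = (\<Sum>b\<in>Basis. partial_deriv b (partial_deriv b f) x)"

definition harmonic_on :: "('a::euclidean_space \<Rightarrow> real) \<Rightarrow> 'a set \<Rightarrow> bool" where
  "harmonic_on f S \<longleftrightarrow> open S \<and> C2_on f S \<and> (\<forall>x\<in>S. laplacian f x = 0)"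

text \<open>The space \<open>\<real>\<^sup>n\<^sup>+\<^sup>1\<close> is rendered as \<open>real ^ 'm\<close> with \<open>CARD('m) = n + 1\<close>. A finite index
  type has no distinguished first element, so the first coordinate is an arbitrary index
  \<open>k\<close>, and \<open>(r, 0, \<dots>, 0)\<close> is \<open>axis k r\<close>.\<close>

end

theory Submission
  imports Defs "HOL-Real_Asymp.Real_Asymp"
begin

text \<open>
  Write \<open>N = n + 1\<close> for the dimension and \<open>e\<close> for the first unit vector. For \<open>t \<ge> 0\<close> the function
  \<open>P\<^sub>t(z) = (1 + t - z \<bullet> e) / |z - (1 + t) e|\<^sup>N\<close> is harmonic off its pole \<open>(1 + t) e\<close>; up to
  a constant it is the Poisson kernel of the half-space \<open>z \<bullet> e < 1 + t\<close>. The function sought is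
  \<open>U = \<Sum>\<^sub>m (m + 1)\<^sup>n (P\<^sub>t - P\<^sub>0)\<close> with \<open>t = 2\<^sup>-\<^sup>m\<close>: positive poles lie at dyadic distances from the sphere
  on the ray through \<open>e\<close>, and every one of them is compensated by an equal negative pole at \<open>e\<close> itself.

  Let \<open>\<rho> = |z - e|\<close> and \<open>y = 1 - z \<bullet> e\<close>, so \<open>1 - |z| \<le> y \<le> \<rho>\<close>, and choose \<open>M\<close> with \<open>2\<^sup>-\<^sup>M\<close> comparable
  to \<open>\<rho>\<close>. The poles with \<open>m \<ge> M\<close> cannot be told from \<open>e\<close> at the distance \<open>\<rho>\<close>: there
  \<open>P\<^sub>t - P\<^sub>0 \<le> t / \<rho>\<^sup>N\<close>, and the weighted sum of these bounds is \<open>O(M\<^sup>n \<rho>\<^sup>-\<^sup>n)\<close>. For \<open>m < M\<close>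
  the positive parts satisfy \<open>P\<^sub>t \<le> t\<^sup>-\<^sup>n\<close> and again add up to \<open>O(M\<^sup>n \<rho>\<^sup>-\<^sup>n)\<close>, while the negative
  parts add up to \<open>P\<^sub>0 = (y/\<rho>) \<rho>\<^sup>-\<^sup>n\<close> times a total weight of order \<open>M\<^sup>n\<^sup>+\<^sup>1\<close>. Altogether
  (\<open>pole_series_le\<close>)
    \<open>U \<le> \<rho>\<^sup>-\<^sup>n M\<^sup>n (K - c (y/\<rho>) M)\<close>.
  On the axis \<open>y = \<rho> = 1 - r\<close> and \<open>M \<ge> ln (1/\<rho>)\<close>, which gives the very negative values. For
  the upper bound, either the bracket is negative, or \<open>M \<le> (K/c) \<rho>/y\<close>, and then
  \<open>\<rho>\<^sup>-\<^sup>n M\<^sup>n K \<le> K (K/c)\<^sup>n y\<^sup>-\<^sup>n\<close>. The exponent \<open>n + 1\<close> of the logarithm is the largest for which this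
  last step works: the \<open>n\<close> factors \<open>M\<close> are exactly paid for by the \<open>n\<close> factors \<open>\<rho>/y\<close>.

  Harmonicity of \<open>U\<close> (\<open>pole_series_harmonic\<close>) comes from termwise differentiation. On a smaller
  ball the kernel and its first two derivatives are Lipschitz, so that the terms and their derivatives
  are \<open>O((m + 1)\<^sup>n 2\<^sup>-\<^sup>m)\<close>.
\<close>

section \<open>Bounded Lipschitz functions\<close>

text \<open>This class is closed under products on every set, bounded or not, convex or not. The Lipschitz
  bounds for the second derivatives of the kernel can thus be read off from their algebraic form,
  with no third derivatives and no segments inside the domain.\<close>

definition bounded_lipschitz :: "'a::real_normed_vector set \<Rightarrow> ('a \<Rightarrow> real) \<Rightarrow> bool" where
  "bounded_lipschitz S f \<longleftrightarrow>
     (\<exists>C. \<forall>x\<in>S. \<forall>y\<in>S. \<bar>f x\<bar> \<le> C \<and> \<bar>f x - f y\<bar> \<le> C * norm (x - y))"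

lemma bounded_lipschitz_const: "bounded_lipschitz S (\<lambda>x. c)"
  unfolding bounded_lipschitz_def by (intro exI[of _ "\<bar>c\<bar>"]) auto

lemma bounded_lipschitz_diff:
  assumes "bounded_lipschitz S f" "bounded_lipschitz S g"
  shows "bounded_lipschitz S (\<lambda>x. f x - g x)"
proof -
  obtain C D where C: "\<And>x y. x \<in> S \<Longrightarrow> y \<in> S \<Longrightarrow> \<bar>f x\<bar> \<le> C \<and> \<bar>f x - f y\<bar> \<le> C * norm (x - y)"
    and D: "\<And>x y. x \<in> S \<Longrightarrow> y \<in> S \<Longrightarrow> \<bar>g x\<bar> \<le> D \<and> \<bar>g x - g y\<bar> \<le> D * norm (x - y)"
    using assms unfolding bounded_lipschitz_def by metis
  show ?thesis
    unfolding bounded_lipschitz_def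
  proof (intro exI[of _ "C + D"] ballI)
    fix x y assume "x \<in> S" "y \<in> S"
    from C[OF this] D[OF this]
    show "\<bar>f x - g x\<bar> \<le> C + D \<and> \<bar>f x - g x - (f y - g y)\<bar> \<le> (C + D) * norm (x - y)"
      unfolding distrib_right by linarith
  qed
qed

lemma bounded_lipschitz_mult:
  assumes "bounded_lipschitz S f" "bounded_lipschitz S g"
  shows "bounded_lipschitz S (\<lambda>x. f x * g x)"
proof -
  obtain C D where C: "\<And>x y. x \<in> S \<Longrightarrow> y \<in> S \<Longrightarrow> \<bar>f x\<bar> \<le> C \<and> \<bar>f x - f y\<bar> \<le> C * norm (x - y)"
    and D: "\<And>x y. x \<in> S \<Longrightarrow> y \<in> S \<Longrightarrow> \<bar>g x\<bar> \<le> D \<and> \<bar>g x - g y\<bar> \<le> D * norm (x - y)"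
    using assms unfolding bounded_lipschitz_def by metis
  have "\<bar>f x * g x\<bar> \<le> 2 * \<bar>C\<bar> * \<bar>D\<bar> \<and> \<bar>f x * g x - f y * g y\<bar> \<le> 2 * \<bar>C\<bar> * \<bar>D\<bar> * norm (x - y)"
    if xy: "x \<in> S" "y \<in> S" for x y
  proof
    have Cx: "\<bar>f x\<bar> \<le> \<bar>C\<bar>" "\<bar>g x\<bar> \<le> \<bar>D\<bar>" "\<bar>g y\<bar> \<le> \<bar>D\<bar>"
      using C[OF xy] D[OF xy] D[OF xy(2) xy(1)] by linarith+
    have "\<bar>f x * g x\<bar> \<le> \<bar>C\<bar> * \<bar>D\<bar>"
      unfolding abs_mult by (intro mult_mono Cx) auto
    moreover have "0 \<le> \<bar>C\<bar> * \<bar>D\<bar>" by simp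
    ultimately show "\<bar>f x * g x\<bar> \<le> 2 * \<bar>C\<bar> * \<bar>D\<bar>" by linarith
    have d: "\<bar>f x - f y\<bar> \<le> \<bar>C\<bar> * norm (x - y)" "\<bar>g x - g y\<bar> \<le> \<bar>D\<bar> * norm (x - y)"
      using C[OF xy] D[OF xy] mult_right_mono[of C "\<bar>C\<bar>" "norm (x - y)"]
        mult_right_mono[of D "\<bar>D\<bar>" "norm (x - y)"] by auto
    have "f x * g x - f y * g y = f x * (g x - g y) + (f x - f y) * g y"
      by (simp add: algebra_simps)
    also have "\<bar>\<dots>\<bar> \<le> \<bar>f x\<bar> * \<bar>g x - g y\<bar> + \<bar>f x - f y\<bar> * \<bar>g y\<bar>"
      by (metis abs_mult abs_triangle_ineq)
    also have "\<dots> \<le> \<bar>C\<bar> * (\<bar>D\<bar> * norm (x - y)) + (\<bar>C\<bar> * norm (x - y)) * \<bar>D\<bar>"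
      by (intro add_mono mult_mono Cx d) auto
    finally show "\<bar>f x * g x - f y * g y\<bar> \<le> 2 * \<bar>C\<bar> * \<bar>D\<bar> * norm (x - y)"
      by (simp add: algebra_simps)
  qed
  then show ?thesis unfolding bounded_lipschitz_def by metis
qed

lemma bounded_lipschitz_power:
  "bounded_lipschitz S f \<Longrightarrow> bounded_lipschitz S (\<lambda>x. f x ^ j)"
  by (induction j) (auto intro: bounded_lipschitz_const bounded_lipschitz_mult)

lemma bounded_lipschitz_inner:
  assumes "\<And>x. x \<in> S \<Longrightarrow> norm x \<le> R"
  shows "bounded_lipschitz S (\<lambda>x. x \<bullet> b)"
  unfolding bounded_lipschitz_def
proof (intro exI[of _ "(1 + R) * norm b"] ballI conjI)
  fix x y assume xy: "x \<in> S" "y \<in> S"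
  have R: "0 \<le> R" using assms[OF xy(1)] norm_ge_zero order_trans by blast
  show "\<bar>x \<bullet> b\<bar> \<le> (1 + R) * norm b"
    using Cauchy_Schwarz_ineq2[of x b] mult_right_mono[of "norm x" "1 + R" "norm b"] assms[OF xy(1)]
    by fastforce
  have "\<bar>x \<bullet> b - y \<bullet> b\<bar> \<le> norm (x - y) * norm b"
    using Cauchy_Schwarz_ineq2[of "x - y" b] by (simp add: inner_diff_left)
  also have "\<dots> \<le> (1 + R) * (norm (x - y) * norm b)"
    using R mult_right_mono[of 1 "1 + R" "norm (x - y) * norm b"] by simp
  finally show "\<bar>x \<bullet> b - y \<bullet> b\<bar> \<le> (1 + R) * norm b * norm (x - y)" by (simp add: algebra_simps)
qed

lemma bounded_lipschitz_inverse_norm: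
  assumes "0 < d" and "\<And>x. x \<in> S \<Longrightarrow> d \<le> norm x"
  shows "bounded_lipschitz S (\<lambda>x. inverse (norm x))"
  unfolding bounded_lipschitz_def
proof (intro exI[of _ "inverse d + inverse d ^ 2"] ballI conjI)
  fix x y assume xy: "x \<in> S" "y \<in> S"
  have i: "inverse (norm x) \<le> inverse d" "inverse (norm y) \<le> inverse d"
    using assms xy by (auto intro: le_imp_inverse_le)
  show "\<bar>inverse (norm x)\<bar> \<le> inverse d + inverse d ^ 2" using i by (simp add: add_increasing2)
  have "inverse (norm x) - inverse (norm y)
      = (norm y - norm x) * (inverse (norm x) * inverse (norm y))"
  proof -
    have "norm x \<noteq> 0" "norm y \<noteq> 0" using assms(1) assms(2)[OF xy(1)] assms(2)[OF xy(2)] by linarith+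
    then show ?thesis by (simp add: field_simps del: norm_eq_zero)
  qed
  also have "\<bar>\<dots>\<bar> \<le> norm (x - y) * (inverse d * inverse d)"
    unfolding abs_mult
    by (intro mult_mono) (use i assms(1) norm_triangle_ineq3[of x y] in \<open>auto simp: abs_minus_commute\<close>)
  also have "\<dots> \<le> (inverse d + inverse d ^ 2) * norm (x - y)"
    using assms(1) by (simp add: power2_eq_square algebra_simps)
  finally show "\<bar>inverse (norm x) - inverse (norm y)\<bar> \<le> (inverse d + inverse d ^ 2) * norm (x - y)" .
qed

section \<open>The kernel and its derivatives\<close>

text \<open>A multiple of the derivative in direction \<open>e\<close> of the fundamental solution of the Laplace
  equation; \<open>- kernel e (z - p)\<close> is a half-space Poisson kernel with pole \<open>p\<close>.\<close>

definition kernel :: "'a::euclidean_space \<Rightarrow> 'a \<Rightarrow> real" where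
  "kernel e w = (w \<bullet> e) * inverse (norm w) ^ DIM('a)"

definition kernel_deriv :: "'a::euclidean_space \<Rightarrow> 'a \<Rightarrow> 'a \<Rightarrow> real" where
  "kernel_deriv e b w = (b \<bullet> e) * inverse (norm w) ^ DIM('a)
     - DIM('a) * ((w \<bullet> e) * (w \<bullet> b)) * inverse (norm w) ^ (DIM('a) + 2)"

definition kernel_deriv2 :: "'a::euclidean_space \<Rightarrow> 'a \<Rightarrow> 'a \<Rightarrow> 'a \<Rightarrow> real" where
  "kernel_deriv2 e b c w =
     DIM('a) * (DIM('a) + 2) * ((w \<bullet> e) * (w \<bullet> b) * (w \<bullet> c)) * inverse (norm w) ^ (DIM('a) + 4)
     - DIM('a) * (b \<bullet> e) * (w \<bullet> c) * inverse (norm w) ^ (DIM('a) + 2)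
     - DIM('a) * (c \<bullet> e) * (w \<bullet> b) * inverse (norm w) ^ (DIM('a) + 2)
     - DIM('a) * (c \<bullet> b) * (w \<bullet> e) * inverse (norm w) ^ (DIM('a) + 2)"

lemma has_derivative_inverse_norm_power:
  fixes w :: "'a::euclidean_space"
  assumes "w \<noteq> 0"
  shows "((\<lambda>x. inverse (norm x) ^ j) has_derivative
          (\<lambda>h. - real j * inverse (norm w) ^ (j + 2) * (w \<bullet> h))) (at w)"
proof -
  have "((\<lambda>x. inverse (norm x)) has_derivative
      (\<lambda>h. - (inverse (norm w) * (sgn w \<bullet> h) * inverse (norm w)))) (at w)"
    using Deriv.has_derivative_inverse[OF _ has_derivative_norm[OF assms]] assms
    by (simp add: inner_commute)
  from has_derivative_power[OF this, of j] show ?thesis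
  proof (rule has_derivative_eq_rhs)
    show "(\<lambda>h. of_nat j * - (inverse (norm w) * (sgn w \<bullet> h) * inverse (norm w)) * inverse (norm w) ^ (j - 1)) =
      (\<lambda>h. - real j * inverse (norm w) ^ (j + 2) * (w \<bullet> h))"
      by (cases j) (auto simp: fun_eq_iff sgn_div_norm algebra_simps)
  qed
qed

lemma has_derivative_kernel:
  assumes "w \<noteq> 0"
  shows "(kernel e has_derivative (\<lambda>h. kernel_deriv e h w)) (at w)"
  unfolding kernel_def[abs_def]
  by (rule has_derivative_eq_rhs, rule has_derivative_mult[OF
        has_derivative_inner_left[OF has_derivative_ident] has_derivative_inverse_norm_power[OF assms]])
    (simp add: fun_eq_iff kernel_deriv_def algebra_simps)

lemma has_derivative_kernel_deriv:
  assumes "w \<noteq> 0"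
  shows "(kernel_deriv e b has_derivative (\<lambda>h. kernel_deriv2 e b h w)) (at w)"
  unfolding kernel_deriv_def[abs_def]
  by (rule has_derivative_eq_rhs, rule has_derivative_diff[OF
        has_derivative_mult_right[OF has_derivative_inverse_norm_power[OF assms]]
        has_derivative_mult[OF has_derivative_mult_right[OF has_derivative_mult[OF
            has_derivative_inner_left[OF has_derivative_ident]
            has_derivative_inner_left[OF has_derivative_ident]]]
          has_derivative_inverse_norm_power[OF assms]]])
    (simp add: fun_eq_iff kernel_deriv2_def algebra_simps numeral_eq_Suc)

lemma kernel_laplacian:
  fixes w :: "'a::euclidean_space"
  assumes "w \<noteq> 0"
  shows "(\<Sum>b\<in>Basis. kernel_deriv2 e b b w) = 0"
proof -
  let ?N = "real DIM('a)" and ?r = "inverse (norm w)"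
  have 1: "(\<Sum>b\<in>Basis. (w \<bullet> b) * (w \<bullet> b)) = norm w ^ 2"
    by (simp add: euclidean_inner[of w w] power2_norm_eq_inner)
  have 2: "(\<Sum>b\<in>Basis. (b \<bullet> e) * (w \<bullet> b)) = w \<bullet> e"
    by (subst euclidean_inner[of w e]) (simp add: inner_commute mult.commute)
  have "(\<Sum>b\<in>Basis. kernel_deriv2 e b b w) =
     (\<Sum>b\<in>Basis. ?N * (?N + 2) * (w \<bullet> e) * ?r ^ (DIM('a) + 4) * ((w \<bullet> b) * (w \<bullet> b))
       - 2 * ?N * ?r ^ (DIM('a) + 2) * ((b \<bullet> e) * (w \<bullet> b)) - ?N * (w \<bullet> e) * ?r ^ (DIM('a) + 2))"
    by (intro sum.cong refl)
       (simp add: kernel_deriv2_def inner_same_Basis algebra_simps)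
  also have "\<dots> = ?N * (?N + 2) * (w \<bullet> e) * ?r ^ (DIM('a) + 4) * norm w ^ 2
       - 2 * ?N * ?r ^ (DIM('a) + 2) * (w \<bullet> e) - ?N * (?N * (w \<bullet> e) * ?r ^ (DIM('a) + 2))"
    unfolding sum_subtractf sum_distrib_left[symmetric] 1 2 by simp
  also have "?r ^ (DIM('a) + 4) = ?r ^ (DIM('a) + 2) * ?r ^ 2"
    by (simp add: numeral_eq_Suc)
  also have "?N * (?N + 2) * (w \<bullet> e) * (?r ^ (DIM('a) + 2) * ?r ^ 2) * norm w ^ 2
     = ?N * (?N + 2) * (w \<bullet> e) * ?r ^ (DIM('a) + 2) * ((?r * norm w) ^ 2)"
    unfolding power_mult_distrib by (simp only: mult.assoc)
  finally show ?thesis using assms by (simp add: algebra_simps)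
qed

section \<open>Termwise differentiation\<close>

text \<open>A bound on the partial derivatives of the terms is a bound on their gradients, since
  there are finitely many coordinates; hence the series of derivatives converges
  uniformly as a series of linear maps.\<close>

lemma has_derivative_suminf:
  fixes f :: "nat \<Rightarrow> 'a::euclidean_space \<Rightarrow> real"
  assumes S: "open S" "convex S" and x: "x \<in> S"
    and f': "\<And>m x. x \<in> S \<Longrightarrow> (f m has_derivative f' m x) (at x)"
    and sm: "\<And>x. x \<in> S \<Longrightarrow> summable (\<lambda>m. f m x)"
    and B: "\<And>b. b \<in> Basis \<Longrightarrow> summable (B b)"
    and le: "\<And>b m x. b \<in> Basis \<Longrightarrow> x \<in> S \<Longrightarrow> \<bar>f' m x b\<bar> \<le> B b m"
  shows "((\<lambda>x. \<Sum>m. f m x) has_derivative (\<lambda>h. \<Sum>m. f' m x h)) (at x)"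
proof -
  define A where "A m = (\<Sum>b\<in>Basis. B b m)" for m
  have A: "summable A" unfolding A_def by (intro summable_sum B)
  have bd: "norm (f' m x h) \<le> A m * norm h" if "x \<in> S" for m x h
  proof -
    interpret bounded_linear "f' m x" using f'[OF that] by (rule has_derivative_bounded_linear)
    have "f' m x h = f' m x (\<Sum>b\<in>Basis. (h \<bullet> b) *\<^sub>R b)" by (simp add: euclidean_representation)
    also have "\<dots> = (\<Sum>b\<in>Basis. (h \<bullet> b) * f' m x b)" by (simp add: sum scaleR)
    also have "norm \<dots> \<le> (\<Sum>b\<in>Basis. norm ((h \<bullet> b) * f' m x b))" by (rule norm_sum)
    also have "\<dots> \<le> (\<Sum>b\<in>Basis. norm h * B b m)"
      by (intro sum_mono) (auto simp: abs_mult Basis_le_norm le that intro!: mult_mono)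
    also have "\<dots> = A m * norm h" by (simp add: A_def sum_distrib_left mult.commute)
    finally show ?thesis .
  qed
  have sf': "summable (\<lambda>m. f' m x h)" if "x \<in> S" for x h
    by (rule summable_comparison_test'[OF summable_mult2[OF A]]) (rule bd[OF that])
  have "\<exists>g. \<forall>x\<in>S. (\<lambda>m. f m x) sums g x \<and> (g has_derivative (\<lambda>h. \<Sum>m. f' m x h)) (at x within S)"
  proof (rule has_derivative_series[where f = f and f' = f', OF S(2) _ _ x summable_sums[OF sm[OF x]]])
    show "(f m has_derivative f' m x) (at x within S)" if "x \<in> S" for m x
      using f'[OF that] has_derivative_at_withinI by blast
    fix \<epsilon> :: real assume \<epsilon>: "\<epsilon> > 0"
    have "(\<lambda>n. \<Sum>m. A (m + n)) \<longlonglongrightarrow> 0" by (rule suminf_exist_split2[OF A])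
    then have "\<forall>\<^sub>F n in sequentially. (\<Sum>m. A (m + n)) < \<epsilon>"
      using \<epsilon> by (rule order_tendstoD)
    then show "\<forall>\<^sub>F n in sequentially. \<forall>x\<in>S. \<forall>h.
        norm ((\<Sum>m<n. f' m x h) - (\<Sum>m. f' m x h)) \<le> \<epsilon> * norm h"
    proof eventually_elim
      case (elim n)
      show ?case
      proof (intro ballI allI)
        fix x h assume xS: "x \<in> S"
        have "(\<Sum>m<n. f' m x h) - (\<Sum>m. f' m x h) = - (\<Sum>m. f' (m + n) x h)"
          using suminf_split_initial_segment[OF sf'[OF xS], where k = n] by simp
        also have "norm \<dots> \<le> (\<Sum>m. A (m + n) * norm h)"
          unfolding norm_minus_cancel
          by (rule norm_suminf_le)
             (auto intro!: summable_mult2 summable_ignore_initial_segment A bd[OF xS, unfolded real_norm_def])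
        also have "\<dots> = (\<Sum>m. A (m + n)) * norm h"
          by (rule suminf_mult2[symmetric]) (rule summable_ignore_initial_segment[OF A])
        also have "\<dots> \<le> \<epsilon> * norm h" using elim by (intro mult_right_mono) auto
        finally show "norm ((\<Sum>m<n. f' m x h) - (\<Sum>m. f' m x h)) \<le> \<epsilon> * norm h" .
      qed
    qed
  qed
  then obtain g where g: "\<And>x. x \<in> S \<Longrightarrow> (\<lambda>m. f m x) sums g x"
    "(g has_derivative (\<lambda>h. \<Sum>m. f' m x h)) (at x within S)" using x by blast
  have "(g has_derivative (\<lambda>h. \<Sum>m. f' m x h)) (at x)"
    using g(2) unfolding at_within_open[OF x S(1)] .
  then show ?thesis
    by (rule has_derivative_transform_within_open[OF _ S(1) x]) (simp add: sums_unique[OF g(1)])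
qed

definition dominated_on :: "'a set \<Rightarrow> (nat \<Rightarrow> 'a \<Rightarrow> real) \<Rightarrow> bool" where
  "dominated_on S F \<longleftrightarrow> (\<exists>B. summable B \<and> (\<forall>m. \<forall>x\<in>S. \<bar>F m x\<bar> \<le> B m))"

lemma dominated_on_summable: "dominated_on S F \<Longrightarrow> x \<in> S \<Longrightarrow> summable (\<lambda>m. F m x)"
  unfolding dominated_on_def
  by (metis real_norm_def summable_comparison_test')

lemma partial_deriv_eqI: "(f has_derivative f') (at x) \<Longrightarrow> partial_deriv b f x = f' b"
  unfolding partial_deriv_def using frechet_derivative_at by metis

lemma harmonic_on_suminf:
  fixes f :: "nat \<Rightarrow> 'a::euclidean_space \<Rightarrow> real"
  assumes S: "open S" "convex S"
    and f': "\<And>m x. x \<in> S \<Longrightarrow> (f m has_derivative (\<lambda>h. f' m h x)) (at x)"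
    and f'': "\<And>m b x. x \<in> S \<Longrightarrow> (f' m b has_derivative (\<lambda>h. f'' m b h x)) (at x)"
    and cont: "\<And>m b c. continuous_on S (f'' m b c)"
    and lap: "\<And>m x. x \<in> S \<Longrightarrow> (\<Sum>b\<in>Basis. f'' m b b x) = 0"
    and dom: "dominated_on S f" "\<And>b. dominated_on S (\<lambda>m. f' m b)"
      "\<And>b c. dominated_on S (\<lambda>m. f'' m b c)"
  shows "harmonic_on (\<lambda>x. \<Sum>m. f m x) S"
proof -
  let ?U = "\<lambda>x. \<Sum>m. f m x"
  have D1: "(?U has_derivative (\<lambda>h. \<Sum>m. f' m h x)) (at x)" if "x \<in> S" for x
  proof -
    obtain B where "\<And>b. summable (B b)" "\<And>b m x. x \<in> S \<Longrightarrow> \<bar>f' m b x\<bar> \<le> B b m"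
      using dom(2) unfolding dominated_on_def by metis
    then show ?thesis
      by (intro has_derivative_suminf[OF S that f', where B = B] dominated_on_summable[OF dom(1)]) auto
  qed
  have D2: "((\<lambda>x. \<Sum>m. f' m b x) has_derivative (\<lambda>h. \<Sum>m. f'' m b h x)) (at x)" if "x \<in> S" for b x
  proof -
    obtain B where "\<And>c. summable (B c)" "\<And>c m x. x \<in> S \<Longrightarrow> \<bar>f'' m b c x\<bar> \<le> B c m"
      using dom(3)[of b] unfolding dominated_on_def by metis
    then show ?thesis
      by (intro has_derivative_suminf[OF S that f'', where B = B] dominated_on_summable[OF dom(2)]) auto
  qed
  have P1: "partial_deriv b ?U x = (\<Sum>m. f' m b x)" if "x \<in> S" for b x
    by (rule partial_deriv_eqI[OF D1[OF that]])
  have D2': "(partial_deriv b ?U has_derivative (\<lambda>h. \<Sum>m. f'' m b h x)) (at x)" if "x \<in> S" for b x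
    by (rule has_derivative_transform_within_open[OF D2[OF that] S(1) that]) (simp add: P1)
  have P2: "partial_deriv c (partial_deriv b ?U) x = (\<Sum>m. f'' m b c x)" if "x \<in> S" for b c x
    by (rule partial_deriv_eqI[OF D2'[OF that]])
  have C: "continuous_on S (\<lambda>x. \<Sum>m. f'' m b c x)" for b c
  proof -
    obtain B where B: "summable B" "\<And>m x. x \<in> S \<Longrightarrow> \<bar>f'' m b c x\<bar> \<le> B m"
      using dom(3)[of b c] unfolding dominated_on_def by metis
    show ?thesis
      by (rule uniform_limit_theorem[OF _ Weierstrass_m_test[OF _ B(1)]])
        (auto intro!: continuous_on_sum cont B(2) always_eventually)
  qed
  have "laplacian ?U x = 0" if "x \<in> S" for x
    unfolding laplacian_def P2[OF that]
    by (subst suminf_sum[symmetric]) (auto intro: dominated_on_summable[OF dom(3) that] simp: lap[OF that])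
  moreover have "C2_on ?U S"
    unfolding C2_on_def differentiable_def using D1 D2' C P2
    by (auto cong: continuous_on_cong)
  ultimately show ?thesis unfolding harmonic_on_def using S(1) by blast
qed

text \<open>The harmonicity of a function is local, so it can be proved on smaller balls, where the dominating
  series exist.\<close>

lemma harmonic_on_Union:
  assumes "\<And>T. T \<in> F \<Longrightarrow> harmonic_on f T"
  shows "harmonic_on f (\<Union>F)"
  using assms unfolding harmonic_on_def C2_on_def
  by (auto intro!: continuous_on_open_Union)

section \<open>The series of poles\<close>

lemma norm_minus_pole_ge:
  assumes "norm e = 1" "t \<ge> 0"
  shows "1 - norm z + t \<le> norm (z - (1 + t) *\<^sub>R e)"
  using norm_triangle_ineq3[of z "(1 + t) *\<^sub>R e"] assms by simp

text \<open>The growth of the charges is what makes the total charge of the first \<open>M\<close> poles larger by a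
  factor \<open>M\<close> than a single charge.\<close>

definition charge :: "nat \<Rightarrow> nat \<Rightarrow> real" where
  "charge n m = real (m + 1) ^ n"

text \<open>The kernel \<open>g\<close> is a parameter so that the term and its derivatives are instances of the
  same expression.\<close>

definition pole_diff :: "nat \<Rightarrow> 'a::euclidean_space \<Rightarrow> ('a \<Rightarrow> real) \<Rightarrow> nat \<Rightarrow> 'a \<Rightarrow> real" where
  "pole_diff n e g m z = charge n m * (g (z - e) - g (z - (1 + (1/2) ^ m) *\<^sub>R e))"

definition pole_series :: "nat \<Rightarrow> 'a::euclidean_space \<Rightarrow> 'a \<Rightarrow> real" where
  "pole_series n e z = (\<Sum>m. pole_diff n e (kernel e) m z)"

lemma summable_poly_geometric: "summable (\<lambda>m. real (m + j) ^ n * (1/2) ^ m)"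
proof (rule summable_comparison_test_bigo)
  show "summable (\<lambda>m. norm ((3/4::real) ^ m))" by simp
  show "(\<lambda>m. real (m + j) ^ n * (1/2) ^ m) \<in> O(\<lambda>m. (3/4) ^ m)"
    by real_asymp
qed

text \<open>The pole moves by \<open>2\<^sup>-\<^sup>m\<close>, and so by the Lipschitz property the difference is of the order
  \<open>2\<^sup>-\<^sup>m\<close>, which beats the charge. From a point of the ball of radius \<open>s\<close> all poles are seen
  at distances between \<open>1 - s\<close> and \<open>3\<close>.\<close>

lemma dominated_pole_diff:
  assumes e: "norm e = 1" and s: "s < 1"
    and g: "bounded_lipschitz {w. 1 - s \<le> norm w \<and> norm w \<le> 3} g"
  shows "dominated_on (ball 0 s) (pole_diff n e g)"
proof -
  let ?A = "{w. 1 - s \<le> norm w \<and> norm w \<le> 3}"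
  obtain C where C: "\<And>x y. x \<in> ?A \<Longrightarrow> y \<in> ?A \<Longrightarrow> \<bar>g x - g y\<bar> \<le> C * norm (x - y)"
    using g unfolding bounded_lipschitz_def by blast
  have "\<bar>pole_diff n e g m z\<bar> \<le> C * (real (m + 1) ^ n * (1/2) ^ m)" if z: "z \<in> ball 0 s" for m z
  proof -
    have mem: "z - (1 + t) *\<^sub>R e \<in> ?A" if "0 \<le> t" "t \<le> 1" for t
      using norm_minus_pole_ge[OF e that(1), of z] norm_triangle_ineq4[of z "(1 + t) *\<^sub>R e"] that z e s
      by auto
    have "\<bar>g (z - e) - g (z - (1 + (1/2) ^ m) *\<^sub>R e)\<bar> \<le> C * norm ((z - e) - (z - (1 + (1/2) ^ m) *\<^sub>R e))"
      by (intro C mem) (use mem[of 0] in \<open>auto simp: power_le_one\<close>)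
    also have "(z - e) - (z - (1 + (1/2) ^ m) *\<^sub>R e) = (1/2::real) ^ m *\<^sub>R e"
      by (simp add: algebra_simps)
    finally show ?thesis
      using e mult_left_mono[of _ _ "charge n m"] by (simp add: pole_diff_def charge_def abs_mult mult_ac)
  qed
  then show ?thesis
    unfolding dominated_on_def
    by (intro exI[of _ "\<lambda>m. C * (real (m + 1) ^ n * (1/2) ^ m)"] conjI summable_mult
        summable_poly_geometric) auto
qed

lemma pole_series_harmonic:
  assumes e: "norm e = 1"
  shows "harmonic_on (pole_series n e) (ball 0 1)"
proof -
  have "harmonic_on (pole_series n e) (ball 0 s)" if s: "s < 1" for s
    unfolding pole_series_def
  proof (rule harmonic_on_suminf[where f' = "\<lambda>m b. pole_diff n e (kernel_deriv e b) m"
        and f'' = "\<lambda>m b c. pole_diff n e (kernel_deriv2 e b c) m"])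
    let ?A = "{w. 1 - s \<le> norm w \<and> norm w \<le> 3} :: 'a set"
    have nz: "z - (1 + t) *\<^sub>R e \<noteq> 0" if "z \<in> ball 0 s" "t \<ge> 0" for z t
      using norm_minus_pole_ge[OF e that(2), of z] that s by auto
    have nz0: "z - e \<noteq> 0" if "z \<in> ball 0 s" for z using nz[OF that, of 0] by simp
    have lin: "bounded_lipschitz ?A (\<lambda>w. w \<bullet> b)" for b
      by (rule bounded_lipschitz_inner[of _ 3]) auto
    have inv: "bounded_lipschitz ?A (\<lambda>w. inverse (norm w))"
      by (rule bounded_lipschitz_inverse_norm[of "1 - s"]) (use s in auto)
    note bl = bounded_lipschitz_diff bounded_lipschitz_mult bounded_lipschitz_const
      bounded_lipschitz_power lin inv
    show "dominated_on (ball 0 s) (pole_diff n e (kernel e))"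
      "dominated_on (ball 0 s) (pole_diff n e (kernel_deriv e b))"
      "dominated_on (ball 0 s) (pole_diff n e (kernel_deriv2 e b c))" for b c
      unfolding kernel_def[abs_def] kernel_deriv_def[abs_def] kernel_deriv2_def[abs_def]
      by (intro dominated_pole_diff[OF e s] bl)+
    show "continuous_on (ball 0 s) (pole_diff n e (kernel_deriv2 e b c) m)" for m b c
      unfolding pole_diff_def kernel_deriv2_def using nz nz0
      by (intro continuous_intros) auto
    show "(\<Sum>b\<in>Basis. pole_diff n e (kernel_deriv2 e b b) m z) = 0" if "z \<in> ball 0 s" for m z
      unfolding pole_diff_def using kernel_laplacian[OF nz[OF that]] kernel_laplacian[OF nz0[OF that]]
      by (simp add: sum_subtractf flip: sum_distrib_left)
    have shift: "((\<lambda>z. g (z - a)) has_derivative g') (at z)" if "(g has_derivative g') (at (z - a))"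
      for g :: "'a \<Rightarrow> real" and g' a z
      using has_derivative_compose[OF has_derivative_diff[OF has_derivative_ident has_derivative_const] that]
      by simp
    show "(pole_diff n e (kernel e) m has_derivative (\<lambda>h. pole_diff n e (kernel_deriv e h) m z)) (at z)"
      if "z \<in> ball 0 s" for m z
      unfolding pole_diff_def[abs_def]
      by (intro has_derivative_mult_right has_derivative_diff shift has_derivative_kernel nz nz0 that) auto
    show "(pole_diff n e (kernel_deriv e b) m has_derivative (\<lambda>h. pole_diff n e (kernel_deriv2 e b h) m z)) (at z)"
      if "z \<in> ball 0 s" for m b z
      unfolding pole_diff_def[abs_def]
      by (intro has_derivative_mult_right has_derivative_diff shift has_derivative_kernel_deriv nz nz0 that) auto
  qed auto
  then have "harmonic_on (pole_series n e) (\<Union>(ball 0 ` {..<1}))"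
    by (intro harmonic_on_Union) auto
  also have "\<Union>(ball 0 ` {..<1}) = ball (0::'a) 1"
    using dense by (fastforce simp: subset_eq)
  finally show ?thesis .
qed

section \<open>The growth estimate\<close>

text \<open>The two regimes. The first bound ignores the position of \<open>z\<close> and serves for poles farther from
  \<open>e\<close> than \<open>z\<close>. The second one holds because moving the pole away from the ball increases its
  distance to \<open>z\<close>; its main part is exactly the value for the pole at \<open>e\<close>, which then cancels.\<close>

lemma neg_kernel_le:
  fixes e :: "'a::euclidean_space"
  assumes e: "norm e = 1" and z: "z \<in> ball 0 1" and t: "t > 0" and N: "DIM('a) = n + 1"
  shows "- kernel e (z - (1 + t) *\<^sub>R e) \<le> inverse t ^ n"
    and "- kernel e (z - (1 + t) *\<^sub>R e) \<le> (1 - z \<bullet> e + t) * inverse (norm (z - e)) ^ DIM('a)"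
proof -
  define y where "y = 1 - z \<bullet> e"
  let ?w = "z - (1 + t) *\<^sub>R e"
  have ee: "e \<bullet> e = 1" using e by (simp add: norm_eq_1)
  have y: "y > 0" using Cauchy_Schwarz_ineq2[of z e] z e by (simp add: y_def)
  have we: "?w \<bullet> e = - (y + t)" by (simp add: inner_diff_left y_def ee)
  have yt: "y + t \<le> norm ?w" using Cauchy_Schwarz_ineq2[of ?w e] e by (simp add: we)
  have wpos: "norm ?w > 0" using yt y t by linarith
  have ratio: "(y + t) * inverse (norm ?w) \<le> 1"
    unfolding divide_inverse[symmetric] divide_le_eq_1_pos[OF wpos] by (rule yt)
  have inv: "inverse (norm ?w) \<le> inverse t"
    using yt y t by (intro le_imp_inverse_le) auto
  have "- kernel e ?w = (y + t) * inverse (norm ?w) * inverse (norm ?w) ^ n"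
    by (simp add: kernel_def we N mult.assoc del: minus_add_distrib)
  also have "\<dots> \<le> 1 * inverse t ^ n"
    by (intro mult_mono power_mono ratio inv) auto
  finally show "- kernel e ?w \<le> inverse t ^ n" by simp
  have pos: "norm (z - e) > 0" using norm_minus_pole_ge[OF e, of 0 z] z by fastforce
  have "?w \<bullet> ?w = (z - e) \<bullet> (z - e) + (2 * t * y + t ^ 2)"
    by (simp add: inner_diff_left inner_diff_right ee inner_commute y_def power2_eq_square algebra_simps)
  then have "norm (z - e) ^ 2 \<le> norm ?w ^ 2" using y t by (simp add: power2_norm_eq_inner)
  then have "norm (z - e) \<le> norm ?w" by (rule power2_le_imp_le) simp
  then have "inverse (norm ?w) ^ DIM('a) \<le> inverse (norm (z - e)) ^ DIM('a)"
    using pos by (intro power_mono le_imp_inverse_le) auto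
  then have "(y + t) * inverse (norm ?w) ^ DIM('a) \<le> (y + t) * inverse (norm (z - e)) ^ DIM('a)"
    using y t by (intro mult_left_mono) auto
  then show "- kernel e ?w \<le> (1 - z \<bullet> e + t) * inverse (norm (z - e)) ^ DIM('a)"
    unfolding kernel_def we y_def[symmetric] mult_minus_left minus_minus .
qed

lemma sum_charge_ge: "real M ^ (n + 1) / real (n + 1) \<le> (\<Sum>m<M. charge n m)"
proof (induction M)
  case (Suc M)
  have "real (Suc M) ^ (n + 1) - real M ^ (n + 1)
      = (real (Suc M) - real M) * (\<Sum>i<Suc n. real (Suc M) ^ i * real M ^ (n - i))"
    using diff_power_eq_sum[of "real (Suc M)" n "real M"] by simp
  also have "\<dots> \<le> (\<Sum>i<Suc n. real (Suc M) ^ n)"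
  proof -
    have "real (Suc M) ^ i * real M ^ (n - i) \<le> real (Suc M) ^ n" if "i < Suc n" for i
    proof -
      have "real (Suc M) ^ i * real M ^ (n - i) \<le> real (Suc M) ^ i * real (Suc M) ^ (n - i)"
        by (intro mult_left_mono power_mono) auto
      also have "\<dots> = real (Suc M) ^ n" using that by (simp flip: power_add)
      finally show ?thesis .
    qed
    moreover have "real (Suc M) - real M = 1" by simp
    ultimately show ?thesis by (simp only: mult_1) (intro sum_mono, blast)
  qed
  finally have "real (Suc M) ^ (n + 1) \<le> real M ^ (n + 1) + real (n + 1) * real (Suc M) ^ n"
    by (simp only: sum_constant card_lessThan) simp
  then have "real (Suc M) ^ (n + 1) / real (n + 1)
      \<le> (real M ^ (n + 1) + real (n + 1) * real (Suc M) ^ n) / real (n + 1)"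
    by (rule divide_right_mono) simp
  also have "\<dots> = real M ^ (n + 1) / real (n + 1) + real (Suc M) ^ n"
    by (simp add: add_divide_distrib del: of_nat_Suc)
  finally have "real (Suc M) ^ (n + 1) / real (n + 1) \<le> real M ^ (n + 1) / real (n + 1) + real (Suc M) ^ n" .
  then show ?case using Suc by (simp add: charge_def add.commute)
qed simp

lemma sum_power_le:
  fixes q :: real
  assumes "q \<ge> 2"
  shows "(\<Sum>m<M. q ^ m) \<le> q ^ M"
proof (induction M)
  case (Suc M)
  then have "(\<Sum>m<Suc M. q ^ m) \<le> 2 * q ^ M" by simp
  also have "\<dots> \<le> q * q ^ M" using assms by (intro mult_right_mono) auto
  finally show ?case by simp
qed simp

definition tail_const :: "nat \<Rightarrow> real" where
  "tail_const n = (\<Sum>m. real (m + 2) ^ n * (1/2) ^ m)"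

text \<open>The number \<open>M\<close> separates the poles that \<open>z\<close> sees as distinct from \<open>e\<close> from those that it
  does not. Both growth statements of the theorem
  are upper bounds for the function, so this one estimate gives both.\<close>

lemma pole_series_le:
  fixes e :: "'a::euclidean_space"
  assumes e: "norm e = 1" and z: "z \<in> ball 0 1" and N: "DIM('a) = n + 1" and n: "n \<ge> 1"
    and M: "M \<ge> 1" "(1/2) ^ M \<le> norm (z - e)" "norm (z - e) \<le> 4 * (1/2) ^ M"
  shows "pole_series n e z \<le> real M ^ n * inverse (norm (z - e)) ^ n *
     (4 ^ n + tail_const n - (1 - z \<bullet> e) * inverse (norm (z - e)) * real M / real (n + 1))"
proof -
  define y where "y = 1 - z \<bullet> e"
  define r where "r = inverse (norm (z - e))"
  define P where "P = y * r ^ (n + 1)"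
  let ?f = "\<lambda>m. pole_diff n e (kernel e) m z"
  have pos: "norm (z - e) > 0" using norm_minus_pole_ge[OF e, of 0 z] z by fastforce
  then have r: "r > 0" by (simp add: r_def)
  have y: "y > 0" using Cauchy_Schwarz_ineq2[of z e] z e by (simp add: y_def)
  have P: "P \<ge> 0" using y r by (simp add: P_def)
  have ee: "e \<bullet> e = 1" using e by (simp add: norm_eq_1)
  have k0: "kernel e (z - e) = - P"
    by (simp add: kernel_def N P_def r_def y_def inner_diff_left ee algebra_simps)
  have c0: "charge n m \<ge> 0" for m by (simp add: charge_def)
  have f1: "?f m \<le> charge n m * (2 ^ n) ^ m - charge n m * P" for m
    using mult_left_mono[OF neg_kernel_le(1)[OF e z _ N, of "(1/2) ^ m"] c0[of m]]
    by (simp add: pole_diff_def k0 right_diff_distrib power_one_over power_mult[symmetric] mult.commute[of n])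
  have f2: "?f m \<le> charge n m * (1/2) ^ m * r ^ (n + 1)" for m
  proof -
    have "- kernel e (z - (1 + (1/2) ^ m) *\<^sub>R e) \<le> (y + (1/2) ^ m) * r ^ (n + 1)"
      using neg_kernel_le(2)[OF e z _ N, of "(1/2) ^ m"] by (simp add: N r_def y_def)
    then have "kernel e (z - e) - kernel e (z - (1 + (1/2) ^ m) *\<^sub>R e) \<le> (1/2) ^ m * r ^ (n + 1)"
      by (simp add: k0 P_def algebra_simps)
    then show ?thesis
      unfolding pole_diff_def mult.assoc by (intro mult_left_mono c0)
  qed
  have split: "(\<Sum>m<M. ?f m) \<le> (\<Sum>m<M. charge n m * (2 ^ n) ^ m) - (\<Sum>m<M. charge n m) * P"
    using sum_mono[of "{..<M}", OF f1] by (simp add: sum_subtractf sum_distrib_right)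
  have "(\<Sum>m<M. charge n m * (2 ^ n) ^ m) \<le> (\<Sum>m<M. real M ^ n * (2 ^ n) ^ m)"
    unfolding charge_def by (intro sum_mono mult_right_mono power_mono) auto
  also have "\<dots> = real M ^ n * (\<Sum>m<M. (2 ^ n) ^ m)" by (simp add: sum_distrib_left)
  also have "\<dots> \<le> real M ^ n * (2 ^ n) ^ M"
    by (intro mult_left_mono sum_power_le) (use n self_le_power[of "2::real" n] in auto)
  also have "\<dots> = real M ^ n * (2 ^ M) ^ n" by (simp add: mult.commute flip: power_mult)
  also have "\<dots> \<le> real M ^ n * (4 * r) ^ n"
    using M(3) pos by (intro mult_left_mono power_mono) (auto simp: r_def field_simps)
  finally have near: "(\<Sum>m<M. charge n m * (2 ^ n) ^ m) \<le> real M ^ n * (4 * r) ^ n" .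
  have head: "(\<Sum>m<M. ?f m) \<le> real M ^ n * (4 * r) ^ n - real M ^ (n + 1) / real (n + 1) * P"
    using split near mult_right_mono[OF sum_charge_ge P, of M n] by linarith
  have sf: "summable ?f"
  proof -
    obtain s where s: "norm z < s" "s < 1" using z dense[of "norm z" 1] by auto
    have "dominated_on (ball 0 s) (pole_diff n e (kernel e))"
      unfolding kernel_def[abs_def]
      by (intro dominated_pole_diff[OF e s(2)] bounded_lipschitz_mult bounded_lipschitz_power
          bounded_lipschitz_inner[of _ 3] bounded_lipschitz_inverse_norm[of "1 - s"]) (use s in auto)
    then show ?thesis by (rule dominated_on_summable) (use s in simp)
  qed
  \<comment> \<open>Factoring \<open>M\<^sup>n\<close> out of the charge leaves a convergent series that does not depend on \<open>M\<close>.\<close>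
  have f3: "?f (m + M) \<le> real M ^ n * r ^ n * (real (m + 2) ^ n * (1/2) ^ m)" for m
  proof -
    have "real (m + M + 1) \<le> real M * real (m + 2)"
    proof -
      have "m + M + 1 \<le> M * (m + 2)" using M(1) by (cases M) auto
      then show ?thesis by (metis of_nat_le_iff of_nat_mult)
    qed
    then have c: "charge n (m + M) \<le> real M ^ n * real (m + 2) ^ n"
      unfolding charge_def power_mult_distrib[symmetric] by (intro power_mono) auto
    have "(1/2) ^ M * r \<le> 1" using M(2) pos by (simp add: r_def field_simps)
    then have q: "((1/2) ^ M * r) * ((1/2) ^ m * r ^ n) \<le> (1/2) ^ m * r ^ n"
      using r by (intro mult_left_le_one_le) auto
    have "?f (m + M) \<le> charge n (m + M) * (((1/2) ^ M * r) * ((1/2) ^ m * r ^ n))"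
      using f2[of "m + M"] by (simp add: power_add mult_ac)
    also have "\<dots> \<le> (real M ^ n * real (m + 2) ^ n) * ((1/2) ^ m * r ^ n)"
      by (intro mult_mono c q) (use r in auto)
    finally show ?thesis by (simp add: mult_ac)
  qed
  have tail: "(\<Sum>m. ?f (m + M)) \<le> real M ^ n * r ^ n * tail_const n"
    unfolding tail_const_def suminf_mult[OF summable_poly_geometric, symmetric]
    by (intro suminf_le f3 summable_mult summable_poly_geometric summable_ignore_initial_segment sf)
  have "pole_series n e z = (\<Sum>m. ?f (m + M)) + (\<Sum>m<M. ?f m)"
    unfolding pole_series_def by (rule suminf_split_initial_segment[OF sf])
  also have "\<dots> \<le> real M ^ n * r ^ n * tail_const n +
      (real M ^ n * (4 * r) ^ n - real M ^ (n + 1) / real (n + 1) * P)"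
    by (intro add_mono tail head)
  also have "\<dots> = real M ^ n * r ^ n * (4 ^ n + tail_const n - y * r * real M / real (n + 1))"
    by (simp add: P_def power_mult_distrib algebra_simps)
  finally show ?thesis by (simp add: r_def y_def)
qed

text \<open>The factor \<open>4\<close> instead of \<open>2\<close> leaves room for \<open>M \<ge> 1\<close> even when \<open>\<rho>\<close> is between \<open>1\<close> and \<open>2\<close>.\<close>

lemma dyadic_scale:
  fixes \<rho> :: real
  assumes "0 < \<rho>" "\<rho> \<le> 2"
  obtains M where "M \<ge> 1" "(1/2) ^ M \<le> \<rho>" "\<rho> \<le> 4 * (1/2) ^ M"
proof -
  obtain M0 where M0: "(1/2) ^ M0 < \<rho>" using real_arch_pow_inv[of \<rho> "1/2"] assms by auto
  define M where "M = (LEAST M. M \<ge> 1 \<and> (1/2) ^ M \<le> \<rho>)"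
  have "(1/2::real) ^ Suc M0 \<le> (1/2) ^ M0" by simp
  then have ex: "Suc M0 \<ge> 1 \<and> (1/2) ^ Suc M0 \<le> \<rho>" using M0 by linarith
  have M: "M \<ge> 1" "(1/2) ^ M \<le> \<rho>" using LeastI[of "\<lambda>M. M \<ge> 1 \<and> (1/2) ^ M \<le> \<rho>", OF ex] by (auto simp: M_def)
  have "\<rho> \<le> 4 * (1/2) ^ M"
  proof (cases "M = 1")
    case False
    then obtain m where m: "M = Suc m" "m \<ge> 1" using M(1) by (cases M) auto
    then have "\<rho> < (1/2) ^ m"
      using not_less_Least[of m "\<lambda>M. M \<ge> 1 \<and> (1/2) ^ M \<le> \<rho>"]
      unfolding M_def[symmetric] by auto
    then show ?thesis using m assms by simp
  qed (use assms in simp)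
  with M that show ?thesis by blast
qed

theorem mainTheorem3:
  fixes n :: nat and k :: "'m::finite"
  assumes "n \<ge> 1" and "CARD('m) = n + 1"
  shows "\<exists>(U :: real ^ 'm \<Rightarrow> real) (C :: real) (C1 :: real).
           harmonic_on U (ball 0 1) \<and> C > 0 \<and> C1 > 0 \<and>
           (\<forall>z\<in>ball 0 1. U z \<le> C / (1 - norm z) ^ n) \<and>
           (\<forall>\<^sub>F r in at_left 1.
              U (axis k r) \<le> - C1 * (1 / (1 - r) ^ n) * (ln (1 / (1 - r))) ^ (n + 1))"
proof -
  define e :: "real ^ 'm" where "e = axis k 1"
  define K where "K = 4 ^ n + tail_const n"
  define c where "c = 1 / real (n + 1)"
  let ?U = "pole_series n e"
  have e: "norm e = 1" by (simp add: e_def)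
  have N: "DIM(real ^ 'm) = n + 1" using assms(2) by simp
  have "tail_const n \<ge> 0"
    unfolding tail_const_def by (intro suminf_nonneg summable_poly_geometric) auto
  then have K: "K > 0" unfolding K_def by (intro add_pos_nonneg) auto
  have c: "c > 0" by (simp add: c_def)
  have geom: "0 < 1 - norm z" "1 - norm z \<le> 1 - z \<bullet> e" "1 - z \<bullet> e \<le> norm (z - e)" "norm (z - e) \<le> 2"
    if "z \<in> ball 0 1" for z
  proof -
    show "0 < 1 - norm z" using that by simp
    show "1 - norm z \<le> 1 - z \<bullet> e" using Cauchy_Schwarz_ineq2[of z e] e by simp
    show "1 - z \<bullet> e \<le> norm (z - e)"
      using Cauchy_Schwarz_ineq2[of "z - e" e] e by (simp add: inner_diff_left norm_eq_1)
    show "norm (z - e) \<le> 2" using norm_triangle_ineq4[of z e] e that by simp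
  qed
  have bound: "\<exists>M\<ge>1. (1/2) ^ M \<le> norm (z - e) \<and> ?U z \<le> real M ^ n * inverse (norm (z - e)) ^ n *
     (K - c * ((1 - z \<bullet> e) * inverse (norm (z - e)) * real M))" if z: "z \<in> ball 0 1" for z
  proof -
    have "0 < norm (z - e)" using geom[OF z] by linarith
    then obtain M where M: "M \<ge> 1" "(1/2) ^ M \<le> norm (z - e)" "norm (z - e) \<le> 4 * (1/2) ^ M"
      using dyadic_scale geom(4)[OF z] by blast
    show ?thesis
      using pole_series_le[OF e z N assms(1) M] M by (intro exI[of _ M]) (auto simp: K_def c_def)
  qed
  have upper: "?U z \<le> K * (K / c) ^ n / (1 - norm z) ^ n" if z: "z \<in> ball 0 1" for z
  proof -
    obtain M where M: "M \<ge> 1" and le: "?U z \<le> real M ^ n * inverse (norm (z - e)) ^ n *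
       (K - c * ((1 - z \<bullet> e) * inverse (norm (z - e)) * real M))" using bound[OF z] by blast
    define y where "y = 1 - z \<bullet> e"
    define r where "r = inverse (norm (z - e))"
    have y: "y > 0" and r: "r > 0" using geom[OF z] by (auto simp: y_def r_def intro: less_le_trans)
    have rhs: "K * (K / c) ^ n / (1 - norm z) ^ n \<ge> 0" using K c z by simp
    \<comment> \<open>Either the negative poles win, or \<open>M\<close> is at most a multiple of \<open>\<rho>/y\<close>.\<close>
    show ?thesis
    proof (cases "K \<le> c * (y * r * real M)")
      case True
      then have "real M ^ n * r ^ n * (K - c * (y * r * real M)) \<le> 0"
        using r by (intro mult_nonneg_nonpos) auto
      then show ?thesis using le rhs by (simp add: y_def r_def)
    next
      case False
      then have Mr: "real M * r \<le> K / c / y" using c y by (simp add: field_simps)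
      have "?U z \<le> real M ^ n * r ^ n * K"
        using le y r c by (fold y_def r_def) (erule order_trans, intro mult_left_mono, auto)
      also have "\<dots> = (real M * r) ^ n * K" by (simp add: power_mult_distrib)
      also have "\<dots> \<le> (K / c / y) ^ n * K" using Mr r K by (intro mult_right_mono power_mono) auto
      also have "\<dots> = K * (K / c) ^ n / y ^ n" by (simp add: power_divide power_mult_distrib)
      also have "\<dots> \<le> K * (K / c) ^ n / (1 - norm z) ^ n"
        using geom[OF z] K c by (intro divide_left_mono power_mono mult_pos_pos zero_less_power) (auto simp: y_def)
      finally show ?thesis .
    qed
  qed
  have lower: "?U (axis k r) \<le> - (c / 2) * (1 / (1 - r) ^ n) * (ln (1 / (1 - r))) ^ (n + 1)"
    if r: "0 < r" "r < 1" and L: "2 * K / c \<le> ln (1 / (1 - r))" for r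
  proof -
    have ax: "axis k r = r *\<^sub>R e" by (simp add: e_def axis_def vec_eq_iff)
    have z: "axis k r \<in> ball 0 1" using r by (simp add: ax e)
    have d: "norm (axis k r - e) = 1 - r"
      using r e norm_scaleR[of "r - 1" e] by (simp add: ax algebra_simps)
    have "axis k r \<bullet> e = r" using e by (simp add: ax norm_eq_1)
    with bound[OF z] d obtain M where M: "(1/2) ^ M \<le> 1 - r" "?U (axis k r) \<le>
       real M ^ n * inverse (1 - r) ^ n * (K - c * real M)" using r by auto
    let ?L = "ln (1 / (1 - r))"
    have "ln ((1/2) ^ M) \<le> ln (1 - r)" using M(1) r by simp
    then have "?L \<le> real M * ln 2" using r by (simp add: ln_realpow ln_div)
    also have "\<dots> \<le> real M * 1" using ln_2_less_1 by (intro mult_left_mono) auto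
    finally have LM: "?L \<le> real M" by simp
    have L0: "?L \<ge> 0" using r by simp
    have "2 * K \<le> c * ?L" using L c by (simp add: pos_divide_le_eq mult.commute)
    moreover have "c * ?L \<le> c * real M" using LM c by (intro mult_left_mono) auto
    ultimately have "2 * K \<le> c * real M" by linarith
    then have "K - c * real M \<le> - (c / 2) * real M" by simp
    then have "?U (axis k r) \<le> real M ^ n * inverse (1 - r) ^ n * (- (c / 2) * real M)"
      using M(2) r by (elim order_trans) (intro mult_left_mono, auto)
    also have "\<dots> = - (c / 2 * (1 / (1 - r) ^ n) * real M ^ (n + 1))"
      by (simp add: field_simps)
    also have "\<dots> \<le> - (c / 2 * (1 / (1 - r) ^ n) * ?L ^ (n + 1))"
      unfolding neg_le_iff_le using c r LM L0 by (intro mult_left_mono power_mono) auto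
    finally show ?thesis by simp
  qed
  have "\<forall>\<^sub>F r in at_left (1::real). 2 * K / c \<le> ln (1 / (1 - r))"
  proof -
    have "filterlim (\<lambda>r::real. ln (1 / (1 - r))) at_top (at_left 1)" by real_asymp
    then show ?thesis unfolding filterlim_at_top by blast
  qed
  moreover have "\<forall>\<^sub>F r in at_left (1::real). r \<in> {0<..<1}"
    by (rule eventually_at_leftI[of 0]) auto
  ultimately have "\<forall>\<^sub>F r in at_left 1.
      ?U (axis k r) \<le> - (c / 2) * (1 / (1 - r) ^ n) * (ln (1 / (1 - r))) ^ (n + 1)"
    by eventually_elim (use lower in auto)
  then show ?thesis
    using pole_series_harmonic[OF e, of n] upper K c
    by (intro exI[of _ ?U] exI[of _ "K * (K / c) ^ n"] exI[of _ "c / 2"]) auto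
qed

end
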